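(* Let $\alpha>0$, $\beta>0$, $\mathbf{X},\mathbf{Y}\in\mathbb{T}_{\alpha\beta}^{p\times q}$ and $r=\min(p,q)$. Suppose that $\mathrm{rank}(\mathbf{Y})=k$ with $1\le k<r$, and let $\mathbf{X}_k=\sum_{i=1}^k\sigma_i\mathbf{u}(i)\mathbf{v}^{\mathtt{H}_1^1}(i)$ be the truncation of the ordered SVD of $\mathbf{X}$ (see context). Then: 1. $\langle\mathbf{X}-\mathbf{X}_k,\mathbf{X}-\mathbf{X}_k\rangle_1\preceq\langle\mathbf{X}-\mathbf{Y},\mathbf{X}-\mathbf{Y}\rangle_1$. 2. $\|\mathbf{X}-\mathbf{X}_k\|_1\le\|\mathbf{X}-\mathbf{Y}\|_1$.
   Context: $\mathbb{T}_{\alpha\beta}$ (the $(\alpha\beta)$-tessarines) is the commutative, associative real algebra with basis $1,\mathrm{i},\mathrm{j},\mathrm{k}$ and multiplication $\mathrm{i}^2=\alpha$, $\mathrm{j}^2=\beta$, $\mathrm{k}^2=\alpha\beta$, $\mathrm{i}\mathrm{j}=\mathrm{k}$, $\mathrm{i}\mathrm{k}=\alpha\mathrm{j}$, $\mathrm{j}\mathrm{k}=\beta\mathrm{i}$. Here $\mathbf{X}^{\mathtt{H}_1^1}=\mathbf{X}^{\mathtt T}$, $\langle\mathbf{X},\mathbf{Y}\rangle_1=\mathrm{trace}(\mathbf{X}^{\mathtt{H}_1^1}\mathbf{Y})\in\mathbb{T}_{\alpha\beta}$ and $\|\mathbf{X}\|_1=\Re\{\langle\mathbf{X},\mathbf{X}\rangle_1\}^{1/2}$,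 where $\Re$ is the coefficient of $1$. Associated tessarine ($\alpha>0$): $\tilde x=\tilde a+\tilde b\mathrm{i}+\tilde c\mathrm{j}+\tilde d\mathrm{k}$ is the associated $(\alpha\beta)$-tessarine of $x$ if $x=\frac{\tilde a+\tilde b+\tilde c+\tilde d}{4}+\frac{\tilde a-\tilde b+\tilde c-\tilde d}{4\sqrt\alpha}\mathrm{i}+\frac{\tilde a+\tilde b-\tilde c-\tilde d}{4\sqrt\beta}\mathrm{j}+\frac{\tilde a-\tilde b-\tilde c+\tilde d}{4\sqrt\alpha\sqrt\beta}\mathrm{k}$; for matrices it is defined entrywise, $\tilde{\mathbf{X}}=\tilde{\mathbf{X}}_1+\tilde{\mathbf{X}}_2\mathrm{i}+\tilde{\mathbf{X}}_3\mathrm{j}+\tilde{\mathbf{X}}_4\mathrm{k}$ with real $\tilde{\mathbf{X}}_n$. $x$ is semipositive if all four components of $\tilde x$ are $\ge0$; $x\preceq y$ means $y-x$ is semipositive. Rank: $\mathrm{rank}(\mathbf{Y})$ is the maximum over $n=1,\dots,4$ of the number of positive singular values (i.e. the real rank) of $\tilde{\mathbf{Y}}_n$. Ordered SVD of $\mathbf{X}$: let $\tilde{\mathbf{X}}_n=\mathbf{U}_n\boldsymbol\Sigma_n\mathbf{V}_n^{\mathtt T}$ be real SVDs ($\mathbf{U}_n\in\mathbb{R}^{p\times p}$, $\mathbf{V}_n\in\mathbb{R}^{q\times q}$ orthogonal) with singular values in nonincreasing order on the diagonal of $\boldsymbol\Sigma_n$. Let $\mathbf{U},\boldsymbol\Sigma,\mathbf{V}$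 be the matrices over $\mathbb{T}_{\alpha\beta}$ with associated matrices $\mathbf{U}_1+\mathbf{U}_2\mathrm{i}+\mathbf{U}_3\mathrm{j}+\mathbf{U}_4\mathrm{k}$, $\boldsymbol\Sigma_1+\boldsymbol\Sigma_2\mathrm{i}+\boldsymbol\Sigma_3\mathrm{j}+\boldsymbol\Sigma_4\mathrm{k}$, $\mathbf{V}_1+\mathbf{V}_2\mathrm{i}+\mathbf{V}_3\mathrm{j}+\mathbf{V}_4\mathrm{k}$, so that $\mathbf{X}=\mathbf{U}\boldsymbol\Sigma\mathbf{V}^{\mathtt{H}_1^1}$. Then $\sigma_i$ is the $(i,i)$ entry of $\boldsymbol\Sigma$ and $\mathbf{u}(i),\mathbf{v}(i)$ are the $i$th columns of $\mathbf{U},\mathbf{V}$. *)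

theory Defs
  imports Complex_Main "Jordan_Normal_Form.DL_Rank"
begin

section \<open>The algebra of tessarines\<close>

datatype tessarine = Tess (t_re: real) (t_i: real) (t_j: real) (t_k: real)

lemma tess_eqI:
  "t_re x = t_re y \<Longrightarrow> t_i x = t_i y \<Longrightarrow> t_j x = t_j y \<Longrightarrow> t_k x = t_k y \<Longrightarrow> x = y"
  by (cases x; cases y) auto

instantiation tessarine :: ab_group_add
begin
definition "0 = Tess 0 0 0 0"
definition "x + y = Tess (t_re x + t_re y) (t_i x + t_i y) (t_j x + t_j y) (t_k x + t_k y)"
definition "x - y = Tess (t_re x - t_re y) (t_i x - t_i y) (t_j x - t_j y) (t_k x - t_k y)"
definition "- x = Tess (- t_re x) (- t_i x) (- t_j x) (- t_k x)"
instance
  by standard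
    (auto simp: zero_tessarine_def plus_tessarine_def minus_tessarine_def uminus_tessarine_def
      algebra_simps)
end

text \<open>The product depends on the parameters \<open>\<alpha>\<close>, \<open>\<beta>\<close>, so it is an ordinary function and not an
  instance of \<^class>\<open>times\<close>; it is the bilinear extension of the multiplication table
  \<open>tess_mult_table\<close> below.\<close>

definition tess_mult :: "real \<Rightarrow> real \<Rightarrow> tessarine \<Rightarrow> tessarine \<Rightarrow> tessarine" where
  "tess_mult \<alpha> \<beta> x y = Tess
     (t_re x * t_re y + \<alpha> * (t_i x * t_i y) + \<beta> * (t_j x * t_j y) + \<alpha> * \<beta> * (t_k x * t_k y))
     (t_re x * t_i y + t_i x * t_re y + \<beta> * (t_j x * t_k y + t_k x * t_j y))
     (t_re x * t_j y + t_j x * t_re y + \<alpha> * (t_i x * t_k y + t_k x * t_i y))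
     (t_re x * t_k y + t_k x * t_re y + t_i x * t_j y + t_j x * t_i y)"

lemma tess_mult_table:
  defines "e \<equiv> Tess 1 0 0 0" and "ii \<equiv> Tess 0 1 0 0"
    and "jj \<equiv> Tess 0 0 1 0" and "kk \<equiv> Tess 0 0 0 1"
  shows "tess_mult \<alpha> \<beta> e x = x" "tess_mult \<alpha> \<beta> ii ii = Tess \<alpha> 0 0 0"
    "tess_mult \<alpha> \<beta> jj jj = Tess \<beta> 0 0 0" "tess_mult \<alpha> \<beta> kk kk = Tess (\<alpha> * \<beta>) 0 0 0"
    "tess_mult \<alpha> \<beta> ii jj = kk" "tess_mult \<alpha> \<beta> ii kk = Tess 0 0 \<alpha> 0"
    "tess_mult \<alpha> \<beta> jj kk = Tess 0 \<beta> 0 0"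
  by (simp_all add: tess_mult_def assms)

lemma tess_mult_commute: "tess_mult \<alpha> \<beta> x y = tess_mult \<alpha> \<beta> y x"
  by (simp add: tess_mult_def algebra_simps)

lemma tess_mult_assoc:
  "tess_mult \<alpha> \<beta> (tess_mult \<alpha> \<beta> x y) z = tess_mult \<alpha> \<beta> x (tess_mult \<alpha> \<beta> y z)"
  by (simp add: tess_mult_def algebra_simps)

lemma tess_mult_add_left:
  "tess_mult \<alpha> \<beta> (x + y) z = tess_mult \<alpha> \<beta> x z + tess_mult \<alpha> \<beta> y z"
  by (simp add: tess_mult_def plus_tessarine_def algebra_simps)


section \<open>Associated tessarines and the semipositive order\<close>

definition is_associated :: "real \<Rightarrow> real \<Rightarrow> tessarine \<Rightarrow> tessarine \<Rightarrow> bool" where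
  "is_associated \<alpha> \<beta> x xt \<longleftrightarrow> x = Tess
     ((t_re xt + t_i xt + t_j xt + t_k xt) / 4)
     ((t_re xt - t_i xt + t_j xt - t_k xt) / (4 * sqrt \<alpha>))
     ((t_re xt + t_i xt - t_j xt - t_k xt) / (4 * sqrt \<beta>))
     ((t_re xt - t_i xt - t_j xt + t_k xt) / (4 * sqrt \<alpha> * sqrt \<beta>))"

definition associated :: "real \<Rightarrow> real \<Rightarrow> tessarine \<Rightarrow> tessarine" where
  "associated \<alpha> \<beta> x = (THE xt. is_associated \<alpha> \<beta> x xt)"

lemma is_associated_iff:
  assumes "\<alpha> > 0" "\<beta> > 0"
  shows "is_associated \<alpha> \<beta> x xt \<longleftrightarrow> xt = Tess
     (t_re x + sqrt \<alpha> * t_i x + sqrt \<beta> * t_j x + sqrt \<alpha> * sqrt \<beta> * t_k x)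
     (t_re x - sqrt \<alpha> * t_i x + sqrt \<beta> * t_j x - sqrt \<alpha> * sqrt \<beta> * t_k x)
     (t_re x + sqrt \<alpha> * t_i x - sqrt \<beta> * t_j x - sqrt \<alpha> * sqrt \<beta> * t_k x)
     (t_re x - sqrt \<alpha> * t_i x - sqrt \<beta> * t_j x + sqrt \<alpha> * sqrt \<beta> * t_k x)"
proof -
  have nz: "sqrt \<alpha> \<noteq> 0" "sqrt \<beta> \<noteq> 0" using assms by auto
  have scale: "u = v / (4 * s) \<longleftrightarrow> s * u = v / 4" if "s \<noteq> 0" for s u v :: real
    using that by (auto simp: field_simps)
  have lin: "(r = (a + b + c + d) / 4 \<and> B = (a - b + c - d) / 4 \<and> C = (a + b - c - d) / 4 \<and>
      D = (a - b - c + d) / 4) \<longleftrightarrow>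
    (a = r + B + C + D \<and> b = r - B + C - D \<and> c = r + B - C - D \<and> d = r - B - C + D)"
    for r B C D a b c d :: real
    by auto
  have "is_associated \<alpha> \<beta> x xt \<longleftrightarrow>
      t_re x = (t_re xt + t_i xt + t_j xt + t_k xt) / 4 \<and>
      sqrt \<alpha> * t_i x = (t_re xt - t_i xt + t_j xt - t_k xt) / 4 \<and>
      sqrt \<beta> * t_j x = (t_re xt + t_i xt - t_j xt - t_k xt) / 4 \<and>
      sqrt \<alpha> * sqrt \<beta> * t_k x = (t_re xt - t_i xt - t_j xt + t_k xt) / 4"
    using scale[OF nz(1)] scale[OF nz(2)] scale[of "sqrt \<alpha> * sqrt \<beta>"] nz
    unfolding is_associated_def
    by (cases x) (simp only: tessarine.inject tessarine.sel mult.assoc mult_eq_0_iff simp_thms)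
  also have "\<dots> \<longleftrightarrow> xt = Tess
     (t_re x + sqrt \<alpha> * t_i x + sqrt \<beta> * t_j x + sqrt \<alpha> * sqrt \<beta> * t_k x)
     (t_re x - sqrt \<alpha> * t_i x + sqrt \<beta> * t_j x - sqrt \<alpha> * sqrt \<beta> * t_k x)
     (t_re x + sqrt \<alpha> * t_i x - sqrt \<beta> * t_j x - sqrt \<alpha> * sqrt \<beta> * t_k x)
     (t_re x - sqrt \<alpha> * t_i x - sqrt \<beta> * t_j x + sqrt \<alpha> * sqrt \<beta> * t_k x)"
    by (cases xt) (simp only: tessarine.inject tessarine.sel lin)
  finally show ?thesis .
qed

lemma associated_eq:
  assumes "\<alpha> > 0" "\<beta> > 0"
  shows "associated \<alpha> \<beta> x = Tess
     (t_re x + sqrt \<alpha> * t_i x + sqrt \<beta> * t_j x + sqrt \<alpha> * sqrt \<beta> * t_k x)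
     (t_re x - sqrt \<alpha> * t_i x + sqrt \<beta> * t_j x - sqrt \<alpha> * sqrt \<beta> * t_k x)
     (t_re x + sqrt \<alpha> * t_i x - sqrt \<beta> * t_j x - sqrt \<alpha> * sqrt \<beta> * t_k x)
     (t_re x - sqrt \<alpha> * t_i x - sqrt \<beta> * t_j x + sqrt \<alpha> * sqrt \<beta> * t_k x)"
  unfolding associated_def is_associated_iff[OF assms] by (rule the_eq_trivial)

definition semipositive :: "real \<Rightarrow> real \<Rightarrow> tessarine \<Rightarrow> bool" where
  "semipositive \<alpha> \<beta> x \<longleftrightarrow> (\<forall>f\<in>{t_re, t_i, t_j, t_k}. f (associated \<alpha> \<beta> x) \<ge> 0)"

definition tess_le :: "real \<Rightarrow> real \<Rightarrow> tessarine \<Rightarrow> tessarine \<Rightarrow> bool" where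
  "tess_le \<alpha> \<beta> x y \<longleftrightarrow> semipositive \<alpha> \<beta> (y - x)"


section \<open>Matrices over the tessarines\<close>

text \<open>Addition, subtraction and transposition are those of \<^type>\<open>mat\<close>; the product has to be
  defined, because it depends on \<open>\<alpha>\<close> and \<open>\<beta>\<close>. Matrix indices start at 0.\<close>

definition tmat_mult :: "real \<Rightarrow> real \<Rightarrow> tessarine mat \<Rightarrow> tessarine mat \<Rightarrow> tessarine mat" where
  "tmat_mult \<alpha> \<beta> A B = mat (dim_row A) (dim_col B)
     (\<lambda>(i, j). \<Sum>l<dim_col A. tess_mult \<alpha> \<beta> (A $$ (i, l)) (B $$ (l, j)))"

definition mat_trace :: "'a::comm_monoid_add mat \<Rightarrow> 'a" where
  "mat_trace A = (\<Sum>i<dim_row A. A $$ (i, i))"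

definition tinner1 :: "real \<Rightarrow> real \<Rightarrow> tessarine mat \<Rightarrow> tessarine mat \<Rightarrow> tessarine" where
  "tinner1 \<alpha> \<beta> X Y = mat_trace (tmat_mult \<alpha> \<beta> X\<^sup>T Y)"

definition tnorm1 :: "real \<Rightarrow> real \<Rightarrow> tessarine mat \<Rightarrow> real" where
  "tnorm1 \<alpha> \<beta> X = sqrt (t_re (tinner1 \<alpha> \<beta> X X))"

text \<open>For \<open>f\<close> one of \<^const>\<open>t_re\<close>, \<^const>\<open>t_i\<close>, \<^const>\<open>t_j\<close>, \<^const>\<open>t_k\<close>, this is the real matrix
  \<open>X~\<^sub>n\<close> (\<open>n = 1, 2, 3, 4\<close> respectively).\<close>

definition assoc_comp ::
    "real \<Rightarrow> real \<Rightarrow> (tessarine \<Rightarrow> real) \<Rightarrow> tessarine mat \<Rightarrow> real mat" where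
  "assoc_comp \<alpha> \<beta> f X = map_mat f (map_mat (associated \<alpha> \<beta>) X)"


section \<open>Singular value decompositions and rank\<close>

definition real_ordered_svd :: "real mat \<Rightarrow> real mat \<Rightarrow> real mat \<Rightarrow> real mat \<Rightarrow> bool" where
  "real_ordered_svd A U S V \<longleftrightarrow>
     U \<in> carrier_mat (dim_row A) (dim_row A) \<and> U\<^sup>T * U = 1\<^sub>m (dim_row A) \<and>
     V \<in> carrier_mat (dim_col A) (dim_col A) \<and> V\<^sup>T * V = 1\<^sub>m (dim_col A) \<and>
     S \<in> carrier_mat (dim_row A) (dim_col A) \<and> diagonal_mat S \<and>
     (\<forall>i < min (dim_row A) (dim_col A). S $$ (i, i) \<ge> 0) \<and>
     (\<forall>j < min (dim_row A) (dim_col A). \<forall>i \<le> j. S $$ (j, j) \<le> S $$ (i, i)) \<and>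
     A = U * S * V\<^sup>T"

definition tess_ordered_svd ::
    "real \<Rightarrow> real \<Rightarrow> tessarine mat \<Rightarrow> tessarine mat \<Rightarrow> tessarine mat \<Rightarrow> tessarine mat \<Rightarrow> bool" where
  "tess_ordered_svd \<alpha> \<beta> X U S V \<longleftrightarrow>
     (\<forall>f\<in>{t_re, t_i, t_j, t_k}.
        real_ordered_svd (assoc_comp \<alpha> \<beta> f X)
          (assoc_comp \<alpha> \<beta> f U) (assoc_comp \<alpha> \<beta> f S) (assoc_comp \<alpha> \<beta> f V))"

text \<open>The sum of the \<open>k\<close> rank-one matrices \<open>\<sigma>(i) u(i) v(i)\<^sup>T\<close>, with \<open>u(i)\<close> and \<open>v(i)\<close> taken as
  one-column matrices. The sum is formed entrywise because \<^type>\<open>mat\<close>, having no zero independent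
  of the dimensions, is not an instance of \<^class>\<open>comm_monoid_add\<close>.\<close>

definition tess_svd_term ::
    "real \<Rightarrow> real \<Rightarrow> tessarine mat \<Rightarrow> tessarine mat \<Rightarrow> tessarine mat \<Rightarrow> nat \<Rightarrow> tessarine mat" where
  "tess_svd_term \<alpha> \<beta> U S V i =
     map_mat (tess_mult \<alpha> \<beta> (S $$ (i, i)))
       (tmat_mult \<alpha> \<beta> (mat_of_cols (dim_row U) [col U i]) (mat_of_cols (dim_row V) [col V i])\<^sup>T)"

definition tess_svd_trunc ::
    "real \<Rightarrow> real \<Rightarrow> tessarine mat \<Rightarrow> tessarine mat \<Rightarrow> tessarine mat \<Rightarrow> nat \<Rightarrow> tessarine mat" where
  "tess_svd_trunc \<alpha> \<beta> U S V k =
     mat (dim_row U) (dim_row V) (\<lambda>ab. \<Sum>i<k. tess_svd_term \<alpha> \<beta> U S V i $$ ab)"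

text \<open>By \<open>real_rank_eq_card_pos_singular_values\<close> below, the real rank is the number of positive
  singular values.\<close>

definition tess_rank :: "real \<Rightarrow> real \<Rightarrow> tessarine mat \<Rightarrow> nat" where
  "tess_rank \<alpha> \<beta> Y =
     Max ((\<lambda>f. vec_space.rank (dim_row Y) (assoc_comp \<alpha> \<beta> f Y)) ` {t_re, t_i, t_j, t_k})"

lemma real_rank_eq_card_pos_singular_values:
  assumes "real_ordered_svd A U S V"
  shows "vec_space.rank (dim_row A) A = card {i. i < min (dim_row A) (dim_col A) \<and> S $$ (i, i) > 0}"
proof -
  define p q where "p = dim_row A" and "q = dim_col A"
  define I where "I = {i. i < min p q \<and> S $$ (i, i) > 0}"
  interpret vec_space "TYPE(real)" p .
  have U: "U \<in> carrier_mat p p" and V: "V \<in> carrier_mat q q" and S: "S \<in> carrier_mat p q"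
    and UU: "U\<^sup>T * U = 1\<^sub>m p" and VV: "V\<^sup>T * V = 1\<^sub>m q"
    and diag: "diagonal_mat S" and nonneg: "\<And>i. i < min p q \<Longrightarrow> S $$ (i, i) \<ge> 0"
    and A_eq: "A = U * S * V\<^sup>T"
    using assms unfolding real_ordered_svd_def p_def q_def by blast+
  have A: "A \<in> carrier_mat p q" by (simp add: p_def q_def)
  have US: "U * S \<in> carrier_mat p q" using U S by simp
  have AV: "A * V = U * S"
    unfolding A_eq using assoc_mult_mat[OF US, of "V\<^sup>T" q V q] US V VV right_mult_one_mat[OF US] by simp
  have "col_space A = col_space (U * S)"
  proof -
    have 1: "A *\<^sub>v x = (U * S) *\<^sub>v (V\<^sup>T *\<^sub>v x)" if "x \<in> carrier_vec q" for x
      unfolding A_eq using US V that by (simp add: assoc_mult_mat_vec[of _ p q _ q])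
    have 2: "(U * S) *\<^sub>v x = A *\<^sub>v (V *\<^sub>v x)" if "x \<in> carrier_vec q" for x
      unfolding AV[symmetric] using A V that by (simp add: assoc_mult_mat_vec[of _ p q _ q])
    have V1: "V\<^sup>T *\<^sub>v x \<in> carrier_vec q" and V2: "V *\<^sub>v x \<in> carrier_vec q" for x
      using carrier_matD[OF V] by (simp_all add: carrier_vecI)
    have dims: "dim_row A = p" "dim_col A = q" "dim_row (U * S) = p" "dim_col (U * S) = q"
      using carrier_matD[OF A] carrier_matD[OF US] by blast+
    show ?thesis
      unfolding col_space_eq[OF A] col_space_eq[OF US] dims
    proof (intro Collect_cong conj_cong refl iffI)
      fix y assume "\<exists>x\<in>carrier_vec q. A *\<^sub>v x = y"
      then show "\<exists>x\<in>carrier_vec q. U * S *\<^sub>v x = y" using 1 V1 by force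
    next
      fix y assume "\<exists>x\<in>carrier_vec q. U * S *\<^sub>v x = y"
      then show "\<exists>x\<in>carrier_vec q. A *\<^sub>v x = y" using 2 V2 by force
    qed
  qed
  then have rank_A: "rank A = rank (U * S)"
    unfolding rank_def col_space_def by simp
  define D where "D = mat p p (\<lambda>(i, j). if i = j then if i \<in> I then S $$ (i, i) else 1 else 0)"
  have D: "D \<in> carrier_mat p p" by (simp add: D_def)
  have "det D = prod_list (diag_mat D)"
    by (rule det_upper_triangular[OF _ D]) (auto simp: D_def upper_triangular_def)
  also have "\<dots> \<noteq> 0"
    by (auto simp: prod_list_zero_iff diag_mat_def D_def I_def)
  finally have detD: "det D \<noteq> 0" .
  have "det U\<^sup>T * det U = 1"
    using UU U det_mult[of "U\<^sup>T" p U] by simp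
  then have detU: "det U \<noteq> 0" by auto
  define M where "M = U * D"
  have M: "M \<in> carrier_mat p p" using U D by (simp add: M_def)
  have "det M \<noteq> 0" using detD detU U D by (simp add: M_def det_mult)
  then have rank_M: "rank M = p" using low_rank_det_zero[OF M] by simp
  then have dist: "distinct (cols M)" using non_distinct_low_rank[OF M] by auto
  have indpt_M: "lin_indpt (set (cols M))" using full_rank_lin_indpt[OF M rank_M dist] .
  have ID: "col S j = col D j" if "j \<in> I" for j
    using that diag S by (intro eq_vecI) (auto simp: D_def I_def diagonal_mat_def)
  have nID: "col S j = 0\<^sub>v p" if "j < q" "j \<notin> I" for j
  proof (rule eq_vecI)
    fix i assume i: "i < dim_vec (0\<^sub>v p :: real vec)"
    show "col S j $ i = 0\<^sub>v p $ i"
      using that i diag S nonneg[of j] by (cases "i = j") (auto simp: I_def diagonal_mat_def)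
  qed (use S in auto)
  define W where "W = col M ` I"
  have col_US: "col (U * S) j = (if j \<in> I then col M j else 0\<^sub>v p)" if "j < q" for j
  proof -
    have "col (U * S) j = U *\<^sub>v col S j" using that by (rule col_mult2[OF U S])
    moreover have "col M j = U *\<^sub>v col D j" if "j \<in> I"
      unfolding M_def using that by (intro col_mult2[OF U D]) (simp add: I_def)
    ultimately show ?thesis using ID nID[OF that] U by auto
  qed
  have W_sub: "W \<subseteq> set (cols M)" using M by (auto simp: W_def I_def cols_def)
  have W_indpt: "lin_indpt W" using subset_li_is_li[OF indpt_M W_sub] .
  have set_US: "set (cols (U * S)) = (\<lambda>j. col (U * S) j) ` {..<q}"
    using US by (auto simp: cols_def)
  have W_US: "W \<subseteq> set (cols (U * S))"
  proof
    fix w assume "w \<in> W"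
    then obtain j where j: "j \<in> I" "w = col M j" by (auto simp: W_def)
    then have "j < q" by (simp add: I_def)
    then show "w \<in> set (cols (U * S))" unfolding set_US
      using j col_US[of j] by (intro image_eqI[of _ _ j]) simp_all
  qed
  have US_W: "set (cols (U * S)) \<subseteq> insert (0\<^sub>v p) W"
    unfolding set_US W_def using col_US by auto
  have "maximal W (\<lambda>T. T \<subseteq> set (cols (U * S)) \<and> lin_indpt T)"
    unfolding maximal_def
  proof (intro conjI allI impI W_US W_indpt; elim conjE)
    fix T assume T: "W \<subseteq> T" "T \<subseteq> set (cols (U * S))" "lin_indpt T"
    have "T \<subseteq> carrier_vec p" using T(2) cols_dim[of "U * S"] carrier_matD(1)[OF US] by simp
    then have "0\<^sub>v p \<notin> T" using vs_zero_lin_dep[of T] T(3) by simp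
    then show "T = W" using T US_W by auto
  qed
  then have "rank (U * S) = card W" by (rule rank_card_indpt[OF US])
  moreover have "inj_on (col M) I"
  proof (rule inj_onI)
    fix i j assume *: "i \<in> I" "j \<in> I" "col M i = col M j"
    then have "i < length (cols M)" "j < length (cols M)" "cols M ! i = cols M ! j"
      using M by (auto simp: I_def)
    then show "i = j" using dist nth_eq_iff_index_eq by blast
  qed
  ultimately show ?thesis
    using rank_A card_image[of "col M" I] by (simp add: W_def I_def p_def q_def)
qed

end

theory Submission
  imports Defs "Jordan_Normal_Form.Gram_Schmidt"
begin

text \<open>Each of the four components of the associated tessarine is a ring homomorphism onto the reals,
  so both claims reduce to the Eckart--Young theorem for real matrices in the Frobenius norm.
  For that theorem, orthogonal invariance replaces \<open>A\<close> by its diagonal factor \<open>S\<close>, and a competitor of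
  rank \<open>m \<le> k\<close> is written as \<open>W Y\<close> with \<open>m\<close> orthonormal columns in \<open>W\<close>. Projecting each column
  \<open>\<sigma>\<^sub>j e\<^sub>j\<close> of \<open>S\<close> to the column space of \<open>W\<close> leaves a residual of at least \<open>\<sigma>\<^sub>j\<^sup>2 (1 - c\<^sub>j)\<close>, where
  \<open>c\<^sub>j\<close> is the squared norm of row \<open>j\<close> of \<open>W\<close>. Since \<open>0 \<le> c\<^sub>j \<le> 1\<close> and the \<open>c\<^sub>j\<close> sum up to at most
  \<open>k\<close>, the total residual is least when the weights \<open>c\<^sub>j\<close> sit on the \<open>k\<close> largest singular values.\<close>

section \<open>Orthonormal families and low-rank factorisations\<close>

lemma orthonormal_residual:
  fixes w :: "nat \<Rightarrow> nat \<Rightarrow> real" and s y :: "nat \<Rightarrow> real"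
  assumes orth: "\<And>l l'. l < m \<Longrightarrow> l' < m \<Longrightarrow> (\<Sum>i<p. w i l * w i l') = of_bool (l = l')"
  shows "(\<Sum>i<p. (s i - (\<Sum>l<m. w i l * y l))\<^sup>2) =
    (\<Sum>i<p. (s i)\<^sup>2) - (\<Sum>l<m. (\<Sum>i<p. s i * w i l)\<^sup>2) + (\<Sum>l<m. (y l - (\<Sum>i<p. s i * w i l))\<^sup>2)"
proof -
  define c where "c l = (\<Sum>i<p. s i * w i l)" for l
  have cross: "(\<Sum>i<p. s i * (\<Sum>l<m. w i l * y l)) = (\<Sum>l<m. y l * c l)"
    unfolding c_def sum_distrib_left
    by (subst sum.swap) (simp add: algebra_simps)
  have "(\<Sum>i<p. (\<Sum>l<m. w i l * y l)\<^sup>2) = (\<Sum>i<p. \<Sum>l<m. \<Sum>l'<m. y l * y l' * (w i l * w i l'))"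
    by (simp add: power2_eq_square sum_product algebra_simps)
  also have "\<dots> = (\<Sum>l<m. \<Sum>i<p. \<Sum>l'<m. y l * y l' * (w i l * w i l'))"
    by (rule sum.swap)
  also have "\<dots> = (\<Sum>l<m. \<Sum>l'<m. \<Sum>i<p. y l * y l' * (w i l * w i l'))"
    by (intro sum.cong refl sum.swap)
  also have "\<dots> = (\<Sum>l<m. \<Sum>l'<m. y l * y l' * (\<Sum>i<p. w i l * w i l'))"
    by (simp add: sum_distrib_left)
  also have "\<dots> = (\<Sum>l<m. \<Sum>l'<m. if l = l' then (y l)\<^sup>2 else 0)"
    by (intro sum.cong refl) (auto simp: orth power2_eq_square)
  also have "\<dots> = (\<Sum>l<m. (y l)\<^sup>2)"
    by simp
  finally have square: "(\<Sum>i<p. (\<Sum>l<m. w i l * y l)\<^sup>2) = (\<Sum>l<m. (y l)\<^sup>2)" .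
  have "(\<Sum>i<p. (s i - (\<Sum>l<m. w i l * y l))\<^sup>2) =
      (\<Sum>i<p. (s i)\<^sup>2) + (\<Sum>i<p. (\<Sum>l<m. w i l * y l)\<^sup>2) - 2 * (\<Sum>i<p. s i * (\<Sum>l<m. w i l * y l))"
    by (simp add: power2_diff sum.distrib sum_subtractf sum_distrib_left mult.assoc)
  also have "\<dots> = (\<Sum>i<p. (s i)\<^sup>2) + (\<Sum>l<m. (y l)\<^sup>2) - 2 * (\<Sum>l<m. y l * c l)"
    unfolding cross square ..
  also have "\<dots> = (\<Sum>i<p. (s i)\<^sup>2) - (\<Sum>l<m. (c l)\<^sup>2) + (\<Sum>l<m. (y l - c l)\<^sup>2)"
    by (simp add: power2_diff sum.distrib sum_subtractf sum_distrib_left mult.assoc)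
  finally show ?thesis unfolding c_def .
qed

text \<open>A maximal independent set of columns spans all columns and has as many elements as the
  rank. Gram-Schmidt and normalisation turn it into \<open>W\<close>, and \<open>Y\<close> collects
  the coordinates of the columns of \<open>B\<close> in this basis.\<close>

lemma rank_orthonormal_factorization:
  fixes B :: "real mat"
  assumes B: "B \<in> carrier_mat p q"
  obtains W Y where "W \<in> carrier_mat p (vec_space.rank p B)" "Y \<in> carrier_mat (vec_space.rank p B) q"
    "W\<^sup>T * W = 1\<^sub>m (vec_space.rank p B)" "B = W * Y"
proof -
  interpret cof_vec_space p "TYPE(real)" .
  define m where "m = rank B"
  have cB: "set (cols B) \<subseteq> carrier_vec p" using B cols_dim by blast
  obtain T where T: "finite T" "maximal T (\<lambda>T. T \<subseteq> set (cols B) \<and> lin_indpt T)"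
    using maximal_exists_superset[of "set (cols B)" "\<lambda>T. T \<subseteq> set (cols B) \<and> lin_indpt T" "{}"]
    by (auto simp: lin_dep_def)
  then have cardT: "card T = m" and T_sub: "T \<subseteq> set (cols B)" and T_ind: "lin_indpt T"
    using rank_card_indpt[OF B] by (auto simp: m_def maximal_def)
  have T_carr: "T \<subseteq> carrier_vec p" using T_sub cB by blast
  \<comment> \<open>Maximality of \<open>T\<close>: a column outside its span could be adjoined
    without losing independence.\<close>
  have cols_span: "c \<in> span T" if c: "c \<in> set (cols B)" for c
  proof (rule ccontr)
    assume nin: "c \<notin> span T"
    have cc: "c \<in> carrier_vec p" using c cB by blast
    have "c \<notin> T" using nin in_own_span[of T] T_carr by auto
    then have "lin_indpt (insert c T)"
      using lin_dep_iff_in_span[of T c] T_carr T_ind nin cc by auto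
    then have "insert c T = T"
      using T(2) T_sub c unfolding maximal_def by blast
    then show False using \<open>c \<notin> T\<close> by blast
  qed
  obtain ws where ws: "set ws = T" "distinct ws"
    using finite_distinct_list[OF T(1)] by blast
  define us where "us = gram_schmidt p ws"
  have gs: "span (set ws) = span (set us)" "corthogonal us" "set us \<subseteq> carrier_vec p"
    "length us = length ws"
    using gram_schmidt_result[of ws us] ws T_carr T_ind us_def by auto
  have len: "length us = m" using gs(4) ws cardT distinct_card by force
  have us_carr: "us ! l \<in> carrier_vec p" if "l < m" for l
    using gs(3) len that by auto
  define U where "U = mat_of_cols p us"
  have U: "U \<in> carrier_mat p m" using mat_of_cols_carrier(1)[of p us] by (simp add: U_def len)
  have cols_U: "cols U = us" unfolding U_def using gs(3) by (rule cols_mat_of_cols)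
  \<comment> \<open>\<open>gram_schmidt\<close> orthogonalises without normalising, so the lengths
    \<open>d l\<close> are divided out of \<open>W\<close> below and multiplied back into
    \<open>Y\<close>.\<close>
  define d where "d l = sqrt (us ! l \<bullet> us ! l)" for l
  have orth: "us ! l \<bullet> us ! l' = 0 \<longleftrightarrow> l \<noteq> l'" if "l < m" "l' < m" for l l'
    using corthogonalD[OF gs(2), of l l'] that len by simp
  have sq_ge: "us ! l \<bullet> us ! l \<ge> 0" for l
    by (simp add: scalar_prod_def sum_nonneg)
  have d_sq: "d l * d l = us ! l \<bullet> us ! l" for l
    by (simp add: d_def sq_ge)
  have d_nz: "d l \<noteq> 0" if "l < m" for l
    using orth[OF that that] by (simp add: d_def)
  have "\<exists>x\<in>carrier_vec m. U *\<^sub>v x = col B j" if "j < q" for j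
  proof -
    have "col B j \<in> span (set us)"
      using cols_span[of "col B j"] that B ws gs(1) by (auto simp: cols_def)
    then have "col B j \<in> col_space U" unfolding col_space_def cols_U .
    then show ?thesis unfolding col_space_eq[OF U] using U by auto
  qed
  then obtain x where x: "\<And>j. j < q \<Longrightarrow> x j \<in> carrier_vec m \<and> U *\<^sub>v x j = col B j"
    by metis
  define W where "W = mat p m (\<lambda>(i, l). us ! l $ i / d l)"
  define Y where "Y = mat m q (\<lambda>(l, j). d l * x j $ l)"
  have "W\<^sup>T * W = 1\<^sub>m m"
  proof (rule eq_matI)
    fix l l' assume "l < dim_row (1\<^sub>m m :: real mat)" "l' < dim_col (1\<^sub>m m :: real mat)"
    then have l: "l < m" "l' < m" by auto
    have "(W\<^sup>T * W) $$ (l, l') = (us ! l \<bullet> us ! l') / (d l * d l')"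
      using l us_carr[OF l(1)] us_carr[OF l(2)]
      by (simp add: W_def scalar_prod_def sum_divide_distrib)
    also have "\<dots> = 1\<^sub>m m $$ (l, l')"
      using l orth[OF l] d_nz[OF l(1)] by (auto simp flip: d_sq)
    finally show "(W\<^sup>T * W) $$ (l, l') = 1\<^sub>m m $$ (l, l')" .
  qed (auto simp: W_def)
  moreover have "B = W * Y"
  proof (rule eq_matI)
    fix i j assume "i < dim_row (W * Y)" "j < dim_col (W * Y)"
    then have ij: "i < p" "j < q" by (auto simp: W_def Y_def)
    have "B $$ (i, j) = (U *\<^sub>v x j) $ i" using x[OF ij(2)] ij B by simp
    also have "\<dots> = (\<Sum>l = 0..<m. us ! l $ i * x j $ l)"
      using ij conjunct1[OF x[OF ij(2)]] len
      by (auto simp: U_def scalar_prod_def mat_of_cols_index intro!: sum.cong)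
    also have "\<dots> = (W * Y) $$ (i, j)"
      using ij d_nz by (simp add: W_def Y_def scalar_prod_def)
    finally show "B $$ (i, j) = (W * Y) $$ (i, j)" .
  qed (use B in \<open>auto simp: W_def Y_def\<close>)
  moreover have "W \<in> carrier_mat p m" "Y \<in> carrier_mat m q"
    by (simp_all add: W_def Y_def)
  ultimately show ?thesis
    using that[of W Y] unfolding m_def by blast
qed

section \<open>The Frobenius norm\<close>

text \<open>The trace form is the real counterpart of \<open>tinner1\<close> on the diagonal, and it
  makes orthogonal factors cancel by matrix algebra alone.\<close>

definition frob_sq :: "real mat \<Rightarrow> real" where
  "frob_sq A = mat_trace (A\<^sup>T * A)"

lemma frob_sq_eq_sum:
  assumes "A \<in> carrier_mat p q"
  shows "frob_sq A = (\<Sum>j<q. \<Sum>i<p. (A $$ (i, j))\<^sup>2)"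
  using assms
  by (auto simp: frob_sq_def mat_trace_def scalar_prod_def power2_eq_square atLeast0LessThan
      intro!: sum.cong)

lemma frob_sq_transpose: "frob_sq A\<^sup>T = frob_sq A"
proof -
  have A: "A \<in> carrier_mat (dim_row A) (dim_col A)" and
    At: "A\<^sup>T \<in> carrier_mat (dim_col A) (dim_row A)" by auto
  show ?thesis unfolding frob_sq_eq_sum[OF A] frob_sq_eq_sum[OF At]
    by (subst sum.swap) (auto intro!: sum.cong)
qed

text \<open>The Gram matrix of \<open>Q * A\<close> contains \<open>Q\<close> only through
  \<open>Q\<^sup>T * Q\<close>, which cancels.\<close>

lemma frob_sq_orthogonal_left:
  assumes "Q \<in> carrier_mat r p" "A \<in> carrier_mat p q" "Q\<^sup>T * Q = 1\<^sub>m p"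
  shows "frob_sq (Q * A) = frob_sq A"
proof -
  have "(Q * A)\<^sup>T * (Q * A) = A\<^sup>T * (Q\<^sup>T * (Q * A))"
    using assms by (simp add: transpose_mult[of Q r p A q] assoc_mult_mat[of _ q p _ r _ q])
  also have "Q\<^sup>T * (Q * A) = (Q\<^sup>T * Q) * A"
    using assms by (intro assoc_mult_mat[of _ p r _ p _ q, symmetric]) auto
  finally show ?thesis using assms by (simp add: frob_sq_def)
qed

lemma frob_sq_orthogonal_right:
  assumes "Q \<in> carrier_mat r q" "A \<in> carrier_mat p q" "Q\<^sup>T * Q = 1\<^sub>m q"
  shows "frob_sq (A * Q\<^sup>T) = frob_sq A"
proof -
  have "(A * Q\<^sup>T)\<^sup>T = Q * A\<^sup>T"
    using assms by (simp add: transpose_mult[of A p q _ r])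
  then show ?thesis
    using frob_sq_orthogonal_left[OF assms(1) _ assms(3), of "A\<^sup>T" p] assms(2)
    by (metis frob_sq_transpose transpose_carrier_mat)
qed

section \<open>The Eckart--Young theorem for real matrices\<close>

text \<open>An exchange argument with threshold \<open>g k\<close>: weight missing before
  \<open>k\<close> costs at least \<open>g k\<close> per unit, weight placed from \<open>k\<close>
  on gains at most \<open>g k\<close> per unit, and the total weight does not exceed
  \<open>k\<close>.\<close>

lemma antimono_weighted_sum_le:
  fixes g c :: "nat \<Rightarrow> real"
  assumes "k \<le> r" and anti: "\<And>i j. i \<le> j \<Longrightarrow> j < r \<Longrightarrow> g j \<le> g i"
    and nonneg: "\<And>i. i < r \<Longrightarrow> 0 \<le> g i" and c: "\<And>i. i < r \<Longrightarrow> 0 \<le> c i \<and> c i \<le> 1"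
    and sum_c: "(\<Sum>i<r. c i) \<le> real k"
  shows "(\<Sum>i<r. g i * c i) \<le> (\<Sum>i<k. g i)"
\<comment> \<open>For \<open>k = r\<close> the threshold \<open>g k\<close> would lie outside the
  range where \<open>g\<close> is controlled; there \<open>c i \<le> 1\<close> suffices.\<close>
proof (cases "k = r")
  case True
  then show ?thesis using c nonneg by (auto intro!: sum_mono mult_left_le)
next
  case False
  then have k: "k < r" using assms(1) by simp
  have split: "{..<r} = {..<k} \<union> {k..<r}" "{..<k} \<inter> {k..<r} = {}" using k by auto
  have sum_split: "(\<Sum>i<r. h i) = (\<Sum>i<k. h i) + (\<Sum>i=k..<r. h i)" for h :: "nat \<Rightarrow> real"
    unfolding split(1) by (rule sum.union_disjoint) auto
  have "(\<Sum>i<k. g i) - (\<Sum>i<r. g i * c i) = (\<Sum>i<k. g i * (1 - c i)) - (\<Sum>i=k..<r. g i * c i)"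
    unfolding sum_split by (simp add: algebra_simps sum_subtractf)
  also have "\<dots> \<ge> (\<Sum>i<k. g k * (1 - c i)) - (\<Sum>i=k..<r. g k * c i)"
    using k anti c by (intro diff_mono sum_mono mult_right_mono) auto
  also have "(\<Sum>i<k. g k * (1 - c i)) - (\<Sum>i=k..<r. g k * c i) = g k * (real k - (\<Sum>i<r. c i))"
    unfolding sum_split by (simp add: algebra_simps sum_subtractf sum_distrib_left)
  finally have "g k * (real k - (\<Sum>i<r. c i)) \<le> (\<Sum>i<k. g i) - (\<Sum>i<r. g i * c i)" .
  moreover have "0 \<le> g k * (real k - (\<Sum>i<r. c i))" using nonneg[OF k] sum_c by simp
  ultimately show ?thesis by simp
qed

text \<open>The lower-bound half of Eckart--Young, in coordinates where the matrix to be
  approximated is diagonal; the bound is the error of the truncation computed in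
  \<open>frob_sq_diff_svd_trunc\<close>.\<close>

lemma diagonal_low_rank_residual_ge:
  fixes S W Y :: "real mat"
  assumes S: "S \<in> carrier_mat p q" and W: "W \<in> carrier_mat p m" and Y: "Y \<in> carrier_mat m q"
    and WW: "W\<^sup>T * W = 1\<^sub>m m" and diag: "diagonal_mat S"
    and nonneg: "\<And>i. i < min p q \<Longrightarrow> 0 \<le> S $$ (i, i)"
    and anti: "\<And>i j. j < min p q \<Longrightarrow> i \<le> j \<Longrightarrow> S $$ (j, j) \<le> S $$ (i, i)"
    and mk: "m \<le> k" and k: "k \<le> min p q"
  shows "(\<Sum>j=k..<min p q. (S $$ (j, j))\<^sup>2) \<le> frob_sq (S - W * Y)"
proof -
  define r where "r = min p q"
  define w where "w i l = W $$ (i, l)" for i l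
  define c where "c i = (\<Sum>l<m. (w i l)\<^sup>2)" for i
  define g where "g i = (S $$ (i, i))\<^sup>2" for i
  have orth: "(\<Sum>i<p. w i l * w i l') = of_bool (l = l')" if "l < m" "l' < m" for l l'
  proof -
    have "(W\<^sup>T * W) $$ (l, l') = (\<Sum>i<p. w i l * w i l')"
      using that W by (simp add: w_def scalar_prod_def atLeast0LessThan)
    then show ?thesis unfolding WW using that by (simp split: if_splits)
  qed
  \<comment> \<open>A sum against column \<open>j\<close> of the diagonal \<open>S\<close> collapses
    to one term. If \<open>p < q\<close>, the columns from \<open>r\<close> on are zero, hence the
    case distinction.\<close>
  have col_S: "(\<Sum>i<p. S $$ (i, j) * h i) = (if j < r then S $$ (j, j) * h j else 0)"
    if "j < q" for j and h :: "nat \<Rightarrow> real"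
  proof -
    have "(\<Sum>i<p. S $$ (i, j) * h i) = (\<Sum>i<p. if i = j then S $$ (j, j) * h j else 0)"
      using that diag S by (intro sum.cong) (auto simp: diagonal_mat_def)
    then show ?thesis using that by (auto simp: r_def)
  qed
  \<comment> \<open>Bessel's inequality for the unit vector at \<open>i\<close>: its coefficients
    against the columns of \<open>W\<close> are the entries \<open>w i l\<close>, so the choice
    \<open>y = w i\<close> makes the residual exactly \<open>1 - c i\<close>.\<close>
  have c_le: "c i \<le> 1" if "i < p" for i
  proof -
    have e: "(\<Sum>a<p. of_bool (a = i) * h a) = h i" for h :: "nat \<Rightarrow> real"
      using that by (simp add: of_bool_def if_distrib[of "\<lambda>x. x * _"] cong: if_cong)
    have e2: "(\<Sum>a<p. (of_bool (a = i) :: real)\<^sup>2) = 1"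
      using e[of "\<lambda>_. 1"] by (simp add: power2_eq_square)
    have "0 \<le> (\<Sum>a<p. (of_bool (a = i) - (\<Sum>l<m. w a l * w i l))\<^sup>2)"
      by (simp add: sum_nonneg)
    also have "\<dots> = 1 - c i"
      using orthonormal_residual[of m w p "\<lambda>a. of_bool (a = i)" "w i"] orth
      unfolding e e2 c_def by simp
    finally show ?thesis by simp
  qed
  have c_ge: "0 \<le> c i" for i by (simp add: c_def sum_nonneg)
  \<comment> \<open>Summed by columns instead of rows, the squared entries of \<open>W\<close>
    contribute 1 for each of its \<open>m\<close> unit columns.\<close>
  have "(\<Sum>i<p. c i) = (\<Sum>l<m. \<Sum>i<p. w i l * w i l)"
    unfolding c_def power2_eq_square by (rule sum.swap)
  also have "\<dots> = real m" using orth by simp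
  finally have "(\<Sum>i<p. c i) = real m" .
  moreover have "(\<Sum>i<r. c i) \<le> (\<Sum>i<p. c i)"
    using c_ge by (intro sum_mono2) (auto simp: r_def)
  ultimately have sum_c: "(\<Sum>i<r. c i) \<le> real k" using mk by simp
  have weighted: "(\<Sum>i<r. g i * c i) \<le> (\<Sum>i<k. g i)"
  proof (rule antimono_weighted_sum_le)
    show "g j \<le> g i" if "i \<le> j" "j < r" for i j
      unfolding g_def using anti[of j i] nonneg[of j] that by (intro power_mono) (auto simp: r_def)
  qed (use k c_le c_ge sum_c in \<open>auto simp: r_def g_def\<close>)
  have "(if j < r then g j * (1 - c j) else 0) \<le> (\<Sum>i<p. ((S - W * Y) $$ (i, j))\<^sup>2)"
    if j: "j < q" for j
  proof -
    have "(\<Sum>i<p. ((S - W * Y) $$ (i, j))\<^sup>2) = (\<Sum>i<p. (S $$ (i, j) - (\<Sum>l<m. w i l * Y $$ (l, j)))\<^sup>2)"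
      using j S W Y by (intro sum.cong) (auto simp: w_def scalar_prod_def atLeast0LessThan)
    \<comment> \<open>Dropping the last sum of \<open>orthonormal_residual\<close> replaces column
      \<open>j\<close> of \<open>Y\<close> by its best choice for the given
      \<open>W\<close>.\<close>
    also have "\<dots> \<ge> (\<Sum>i<p. (S $$ (i, j))\<^sup>2) - (\<Sum>l<m. (\<Sum>i<p. S $$ (i, j) * w i l)\<^sup>2)"
      by (subst orthonormal_residual[OF orth]) (auto simp: sum_nonneg)
    also have "(\<Sum>i<p. (S $$ (i, j))\<^sup>2) = (if j < r then g j else 0)"
      using col_S[OF j, of "\<lambda>i. S $$ (i, j)"] by (simp add: g_def power2_eq_square)
    also have "(\<Sum>l<m. (\<Sum>i<p. S $$ (i, j) * w i l)\<^sup>2) = (if j < r then g j * c j else 0)"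
      unfolding col_S[OF j] by (simp add: g_def c_def sum_distrib_left power_mult_distrib)
    finally show ?thesis by (auto simp: algebra_simps split: if_splits)
  qed
  then have "(\<Sum>j<q. if j < r then g j * (1 - c j) else 0) \<le> frob_sq (S - W * Y)"
    using S W Y by (subst frob_sq_eq_sum[of _ p q]) (auto intro!: sum_mono)
  moreover have "(\<Sum>j<q. if j < r then g j * (1 - c j) else 0) = (\<Sum>j<r. g j * (1 - c j))"
    by (rule sum.mono_neutral_cong_right) (auto simp: r_def)
  moreover have "(\<Sum>j<r. g j) = (\<Sum>j<k. g j) + (\<Sum>j=k..<r. g j)"
    using k by (subst sum.union_disjoint[symmetric]) (auto simp: r_def intro!: sum.cong)
  ultimately show ?thesis using weighted
    by (simp add: algebra_simps sum_subtractf g_def r_def)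
qed

text \<open>Bracketed like the entries of \<open>tess_svd_term\<close>, so that the components of
  the tessarine truncation can be compared entry by entry.\<close>

definition svd_trunc :: "real mat \<Rightarrow> real mat \<Rightarrow> real mat \<Rightarrow> nat \<Rightarrow> real mat" where
  "svd_trunc U S V k = mat (dim_row U) (dim_row V)
     (\<lambda>(a, b). \<Sum>i<k. S $$ (i, i) * (U $$ (a, i) * V $$ (b, i)))"

text \<open>Split \<open>S\<close> at index \<open>k\<close> into a head \<open>D\<close> and a tail
  \<open>R\<close>. The truncation is \<open>U * D * V\<^sup>T\<close>, so the error is
  \<open>U * R * V\<^sup>T\<close>, which has the norm of \<open>R\<close> by orthogonal
  invariance.\<close>

lemma frob_sq_diff_svd_trunc:
  assumes svd: "real_ordered_svd A U S V" and A: "A \<in> carrier_mat p q" and k: "k \<le> min p q"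
  shows "frob_sq (A - svd_trunc U S V k) = (\<Sum>j=k..<min p q. (S $$ (j, j))\<^sup>2)"
proof -
  have U: "U \<in> carrier_mat p p" and V: "V \<in> carrier_mat q q" and S: "S \<in> carrier_mat p q"
    and UU: "U\<^sup>T * U = 1\<^sub>m p" and VV: "V\<^sup>T * V = 1\<^sub>m q"
    and diag: "diagonal_mat S" and A_eq: "A = U * S * V\<^sup>T"
    using svd A unfolding real_ordered_svd_def by auto
  define R where "R = mat p q (\<lambda>(i, j). if i = j \<and> k \<le> i then S $$ (i, i) else 0)"
  define D where "D = mat p q (\<lambda>(i, j). if i = j \<and> i < k then S $$ (i, i) else 0)"
  have R: "R \<in> carrier_mat p q" and D: "D \<in> carrier_mat p q" by (auto simp: R_def D_def)
  have UD: "(U * D) $$ (a, j) = (if j < k then U $$ (a, j) * S $$ (j, j) else 0)"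
    if "a < p" "j < q" for a j
  proof -
    have "(U * D) $$ (a, j) = (\<Sum>i<p. if i = j then (if j < k then U $$ (a, j) * S $$ (j, j) else 0) else 0)"
      using that U k
      by (subst index_mult_mat)
        (auto simp: D_def scalar_prod_def atLeast0LessThan simp del: sum.delta intro!: sum.cong)
    then show ?thesis using k that by auto
  qed
  define E where "E = U * D"
  have E: "E \<in> carrier_mat p q" using U D by (simp add: E_def)
  have "svd_trunc U S V k = U * D * V\<^sup>T"
  proof (rule eq_matI)
    fix a b assume "a < dim_row (U * D * V\<^sup>T)" "b < dim_col (U * D * V\<^sup>T)"
    then have ab: "a < p" "b < q" using U V by auto
    have "(U * D * V\<^sup>T) $$ (a, b) = (\<Sum>j<q. (U * D) $$ (a, j) * V $$ (b, j))"
      using ab E V unfolding E_def[symmetric]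
      by (simp add: scalar_prod_def atLeast0LessThan)
    also have "\<dots> = (\<Sum>j<q. if j < k then S $$ (j, j) * (U $$ (a, j) * V $$ (b, j)) else 0)"
      using ab by (intro sum.cong) (auto simp: UD)
    also have "\<dots> = (\<Sum>j<k. S $$ (j, j) * (U $$ (a, j) * V $$ (b, j)))"
      using k by (intro sum.mono_neutral_cong_right) auto
    finally show "svd_trunc U S V k $$ (a, b) = (U * D * V\<^sup>T) $$ (a, b)"
      using ab U V by (simp add: svd_trunc_def)
  qed (use U V in \<open>auto simp: svd_trunc_def\<close>)
  moreover have "R = S - D"
    using S diag by (intro eq_matI) (auto simp: R_def D_def diagonal_mat_def)
  ultimately have "A - svd_trunc U S V k = U * R * V\<^sup>T"
    unfolding A_eq using U V S D
    by (simp add: mult_minus_distrib_mat[of _ p p] minus_mult_distrib_mat[of _ p q])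
  then have "frob_sq (A - svd_trunc U S V k) = frob_sq R"
    using frob_sq_orthogonal_right[OF V _ VV, of "U * R" p] frob_sq_orthogonal_left[OF U R UU] U R
    by simp
  also have "\<dots> = (\<Sum>j<q. if j \<in> {k..<min p q} then (S $$ (j, j))\<^sup>2 else 0)"
  proof -
    have "(\<Sum>i<p. (R $$ (i, j))\<^sup>2) =
        (\<Sum>i<p. if i = j then (if k \<le> j then (S $$ (j, j))\<^sup>2 else 0) else 0)" if "j < q" for j
      using that by (intro sum.cong) (auto simp: R_def)
    then show ?thesis unfolding frob_sq_eq_sum[OF R] by (intro sum.cong) auto
  qed
  also have "\<dots> = (\<Sum>j=k..<min p q. (S $$ (j, j))\<^sup>2)"
    by (rule sum.mono_neutral_cong_right) auto
  finally show ?thesis .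
qed

text \<open>Orthogonal invariance carries the competitor \<open>B\<close> into the singular bases of
  \<open>A\<close>, where the diagonal lower bound meets the exact error of the truncation.\<close>

theorem real_eckart_young:
  assumes svd: "real_ordered_svd A U S V" and A: "A \<in> carrier_mat p q" and B: "B \<in> carrier_mat p q"
    and rank: "vec_space.rank p B \<le> k" and k: "k \<le> min p q"
  shows "frob_sq (A - svd_trunc U S V k) \<le> frob_sq (A - B)"
proof -
  have U: "U \<in> carrier_mat p p" and V: "V \<in> carrier_mat q q" and S: "S \<in> carrier_mat p q"
    and UU: "U\<^sup>T * U = 1\<^sub>m p" and VV: "V\<^sup>T * V = 1\<^sub>m q"
    and diag: "diagonal_mat S" and nonneg: "\<And>i. i < min p q \<Longrightarrow> S $$ (i, i) \<ge> 0"
    and anti: "\<And>i j. j < min p q \<Longrightarrow> i \<le> j \<Longrightarrow> S $$ (j, j) \<le> S $$ (i, i)"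
    and A_eq: "A = U * S * V\<^sup>T"
    using svd A unfolding real_ordered_svd_def by auto
  have UU': "U * U\<^sup>T = 1\<^sub>m p" and VV': "V * V\<^sup>T = 1\<^sub>m q"
    using mat_mult_left_right_inverse[OF _ U UU] mat_mult_left_right_inverse[OF _ V VV] U V by auto
  define m where "m = vec_space.rank p B"
  obtain W Y where W: "W \<in> carrier_mat p m" and Y: "Y \<in> carrier_mat m q"
    and WW: "W\<^sup>T * W = 1\<^sub>m m" and B_eq: "B = W * Y"
    using rank_orthonormal_factorization[OF B] unfolding m_def by blast
  \<comment> \<open>\<open>W' * Y'\<close> factorises \<open>U\<^sup>T * B * V\<close>; the columns
    of \<open>W'\<close> stay orthonormal because \<open>U\<close> is orthogonal.\<close>
  define W' where "W' = U\<^sup>T * W"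
  define Y' where "Y' = Y * V"
  have W': "W' \<in> carrier_mat p m" and Y': "Y' \<in> carrier_mat m q"
    using U V W Y by (auto simp: W'_def Y'_def)
  have UW': "U * W' = W"
    unfolding W'_def using U W UU' by (simp flip: assoc_mult_mat[of U p p "U\<^sup>T" p W m])
  have YV': "Y' * V\<^sup>T = Y"
    unfolding Y'_def using V Y VV' by (simp add: assoc_mult_mat[of Y m q V q "V\<^sup>T" q])
  have "W'\<^sup>T = W\<^sup>T * U" unfolding W'_def using U W by (simp add: transpose_mult[of _ p p _ m])
  then have "W'\<^sup>T * W' = W\<^sup>T * (U * W')"
    using U W W' by (simp add: assoc_mult_mat[of _ m p _ p])
  then have WW': "W'\<^sup>T * W' = 1\<^sub>m m" using UW' WW by simp
  have "U * (W' * Y') * V\<^sup>T = U * W' * Y' * V\<^sup>T"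
    using assoc_mult_mat[OF U W' Y'] by simp
  also have "\<dots> = U * W' * (Y' * V\<^sup>T)"
    using U V W' Y' by (intro assoc_mult_mat[of _ p m _ q]) auto
  finally have "U * (W' * Y') * V\<^sup>T = B" by (simp add: UW' YV' B_eq)
  moreover have "U * (S - W' * Y') * V\<^sup>T = U * S * V\<^sup>T - U * (W' * Y') * V\<^sup>T"
    using U V S W' Y'
    by (simp add: mult_minus_distrib_mat[of _ p p] minus_mult_distrib_mat[of _ p q])
  ultimately have AB: "A - B = U * (S - W' * Y') * V\<^sup>T" unfolding A_eq by simp
  have "S - W' * Y' \<in> carrier_mat p q" using S W' Y' by auto
  then have "frob_sq (A - B) = frob_sq (S - W' * Y')"
    unfolding AB using U
    by (subst frob_sq_orthogonal_right[OF V _ VV, of _ p])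
      (auto intro: frob_sq_orthogonal_left[OF U _ UU])
  then show ?thesis
    using diagonal_low_rank_residual_ge[OF S W' Y' WW' diag nonneg anti _ k] rank
      frob_sq_diff_svd_trunc[OF svd A k]
    by (simp add: m_def)
qed

section \<open>Components of the associated tessarine\<close>

context
  fixes \<alpha> \<beta> :: real and f :: "tessarine \<Rightarrow> real"
  assumes pos: "\<alpha> > 0" "\<beta> > 0" and f: "f \<in> {t_re, t_i, t_j, t_k}"
begin

lemma associated_comp_zero: "f (associated \<alpha> \<beta> 0) = 0"
  using f by (auto simp: associated_eq[OF pos] zero_tessarine_def)

lemma associated_comp_add:
  "f (associated \<alpha> \<beta> (x + y)) = f (associated \<alpha> \<beta> x) + f (associated \<alpha> \<beta> y)"
  using f by (auto simp: associated_eq[OF pos] plus_tessarine_def algebra_simps)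

lemma associated_comp_diff:
  "f (associated \<alpha> \<beta> (x - y)) = f (associated \<alpha> \<beta> x) - f (associated \<alpha> \<beta> y)"
  using f by (auto simp: associated_eq[OF pos] minus_tessarine_def algebra_simps)

text \<open>Each component evaluates a tessarine at i = \<plusminus>sqrt \<alpha> and j =
  \<plusminus>sqrt \<beta>, with k sent to the product of these values. The substitution respects
  the multiplication table, and the four sign choices give the four components.\<close>

lemma associated_comp_mult:
  "f (associated \<alpha> \<beta> (tess_mult \<alpha> \<beta> x y)) = f (associated \<alpha> \<beta> x) * f (associated \<alpha> \<beta> y)"
proof -
  define s t where "s = sqrt \<alpha>" and "t = sqrt \<beta>"
  have "\<alpha> = s * s" "\<beta> = t * t" using pos by (auto simp: s_def t_def)
  then show ?thesis
    using f unfolding associated_eq[OF pos] s_def[symmetric] t_def[symmetric]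
    by (auto simp: tess_mult_def algebra_simps)
qed

lemma associated_comp_sum:
  "f (associated \<alpha> \<beta> (sum h I)) = (\<Sum>i\<in>I. f (associated \<alpha> \<beta> (h i)))"
  by (induction I rule: infinite_finite_induct)
    (auto simp: associated_comp_zero associated_comp_add)

lemma assoc_comp_diff:
  assumes "A \<in> carrier_mat p q" "B \<in> carrier_mat p q"
  shows "assoc_comp \<alpha> \<beta> f (A - B) = assoc_comp \<alpha> \<beta> f A - assoc_comp \<alpha> \<beta> f B"
  using assms by (intro eq_matI) (auto simp: assoc_comp_def associated_comp_diff)

lemma associated_comp_tinner1_self:
  "f (associated \<alpha> \<beta> (tinner1 \<alpha> \<beta> A A)) = frob_sq (assoc_comp \<alpha> \<beta> f A)"
  by (auto simp: tinner1_def tmat_mult_def mat_trace_def frob_sq_def assoc_comp_def scalar_prod_def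
      associated_comp_sum associated_comp_mult atLeast0LessThan intro!: sum.cong)

text \<open>The components commute with sums and products. The bound on \<open>k\<close> keeps all
  indices inside the matrices, where the entries of \<open>assoc_comp\<close> are
  determined.\<close>

lemma assoc_comp_svd_trunc:
  assumes "U \<in> carrier_mat p p" "V \<in> carrier_mat q q" "S \<in> carrier_mat p q" "k \<le> min p q"
  shows "assoc_comp \<alpha> \<beta> f (tess_svd_trunc \<alpha> \<beta> U S V k) =
    svd_trunc (assoc_comp \<alpha> \<beta> f U) (assoc_comp \<alpha> \<beta> f S) (assoc_comp \<alpha> \<beta> f V) k"
  using assms
  by (intro eq_matI)
    (auto simp: assoc_comp_def tess_svd_trunc_def svd_trunc_def tess_svd_term_def tmat_mult_def
      mat_of_cols_index associated_comp_sum associated_comp_mult intro!: sum.cong)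

end

lemma t_re_eq_mean_associated:
  assumes "\<alpha> > 0" "\<beta> > 0"
  shows "t_re x = (t_re (associated \<alpha> \<beta> x) + t_i (associated \<alpha> \<beta> x) + t_j (associated \<alpha> \<beta> x) +
    t_k (associated \<alpha> \<beta> x)) / 4"
  by (simp add: associated_eq[OF assms])

text \<open>The real part is the mean of the four associated components, so it is nonnegative on
  semipositive tessarines. This derives the norm inequality from the order relation.\<close>

lemma tess_le_imp_t_re_le:
  assumes "\<alpha> > 0" "\<beta> > 0" "tess_le \<alpha> \<beta> x y"
  shows "t_re x \<le> t_re y"
proof -
  have "0 \<le> t_re (y - x)"
    using assms(3) t_re_eq_mean_associated[OF assms(1,2), of "y - x"]
    by (simp add: tess_le_def semipositive_def)
  then show ?thesis by (simp add: minus_tessarine_def)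
qed

theorem theorem6:
  fixes \<alpha> \<beta> :: real and p q k :: nat
    and X Y U S V :: "tessarine mat"
  assumes "\<alpha> > 0" and "\<beta> > 0"
    and "X \<in> carrier_mat p q" and "Y \<in> carrier_mat p q"
    and "tess_rank \<alpha> \<beta> Y = k" and "1 \<le> k" and "k < min p q"
    and "tess_ordered_svd \<alpha> \<beta> X U S V"
  shows "tess_le \<alpha> \<beta>
           (tinner1 \<alpha> \<beta> (X - tess_svd_trunc \<alpha> \<beta> U S V k) (X - tess_svd_trunc \<alpha> \<beta> U S V k))
           (tinner1 \<alpha> \<beta> (X - Y) (X - Y)) \<and>
         tnorm1 \<alpha> \<beta> (X - tess_svd_trunc \<alpha> \<beta> U S V k) \<le> tnorm1 \<alpha> \<beta> (X - Y)"
proof -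
  let ?Xk = "tess_svd_trunc \<alpha> \<beta> U S V k"
  have svd: "real_ordered_svd (assoc_comp \<alpha> \<beta> f X)
      (assoc_comp \<alpha> \<beta> f U) (assoc_comp \<alpha> \<beta> f S) (assoc_comp \<alpha> \<beta> f V)"
    if "f \<in> {t_re, t_i, t_j, t_k}" for f
    using assms(8) that unfolding tess_ordered_svd_def by blast
  have comp_carrier: "assoc_comp \<alpha> \<beta> f M \<in> carrier_mat a b \<longleftrightarrow> M \<in> carrier_mat a b" for f M a b
    unfolding assoc_comp_def by simp
  \<comment> \<open>\<open>assoc_comp\<close> preserves dimensions, so any single component of the
    decomposition fixes the shapes of the tessarine factors.\<close>
  have U: "U \<in> carrier_mat p p" and V: "V \<in> carrier_mat q q" and S: "S \<in> carrier_mat p q"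
    using svd[of t_re] assms(3) unfolding real_ordered_svd_def comp_carrier
    by (simp_all add: assoc_comp_def)
  have Xk: "?Xk \<in> carrier_mat p q" using U V by (auto simp: tess_svd_trunc_def)
  have le: "tess_le \<alpha> \<beta> (tinner1 \<alpha> \<beta> (X - ?Xk) (X - ?Xk)) (tinner1 \<alpha> \<beta> (X - Y) (X - Y))"
    unfolding tess_le_def semipositive_def
  proof
    fix f assume f: "f \<in> {t_re, t_i, t_j, t_k}"
    \<comment> \<open>The tessarine rank is a maximum, so \<open>k\<close> bounds the rank of every
      component, and each real truncation at the same \<open>k\<close> beats its competitor.\<close>
    have "vec_space.rank (dim_row Y) (assoc_comp \<alpha> \<beta> f Y) \<le> tess_rank \<alpha> \<beta> Y"
      unfolding tess_rank_def using f by (intro Max_ge) auto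
    then have "vec_space.rank p (assoc_comp \<alpha> \<beta> f Y) \<le> k" using assms(4,5) by simp
    then have "frob_sq (assoc_comp \<alpha> \<beta> f (X - ?Xk)) \<le> frob_sq (assoc_comp \<alpha> \<beta> f (X - Y))"
      using real_eckart_young[OF svd[OF f], of p q "assoc_comp \<alpha> \<beta> f Y" k] assms(3,4,7)
      by (simp add: comp_carrier assoc_comp_diff[OF assms(1,2) f assms(3) Xk]
          assoc_comp_diff[OF assms(1,2) f assms(3,4)] assoc_comp_svd_trunc[OF assms(1,2) f U V S])
    then show "0 \<le> f (associated \<alpha> \<beta>
        (tinner1 \<alpha> \<beta> (X - Y) (X - Y) - tinner1 \<alpha> \<beta> (X - ?Xk) (X - ?Xk)))"
      by (simp add: associated_comp_diff[OF assms(1,2) f] associated_comp_tinner1_self[OF assms(1,2) f])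
  qed
  then show ?thesis
    using tess_le_imp_t_re_le[OF assms(1,2)] by (simp add: tnorm1_def)
qed

end
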